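(* Let $n\ge 1$ and let $\sigma=s_1\cdots s_n\in S_n$ be a permutation. Then $$|\varphi^{-1}(\sigma)|=\prod_{i=1}^n \ell(i;\sigma),$$ where $\ell(i;\sigma)$ is the length of the longest subsequence $s_j\cdots s_i$ of consecutive entries of $\sigma$ such that $s_t\le s_i$ for all $j\le t\le i$.
   Context: Write $[n]=\{1,\dots,n\}$. A street has parking spots $1,\dots,n$ in order, and cars $c_1,\dots,c_n$ arrive in this order. Given $\alpha=(a_1,\dots,a_n)\in[n]^n$, car $c_i$ drives to its preferred spot $a_i$ and parks there if it is empty; otherwise it continues forward and parks in the first empty spot after $a_i$, if there is one (otherwise it fails to park). The tuple $\alpha$ is a parking function of length $n$ if all $n$ cars park; $PF_n$ is the set of parking functions of length $n$. $S_n$ is the symmetric group on $[n]$, with permutations in one-line notation. The map $\varphi:PF_n\to S_n$ sends $\alpha$ to $s_1s_2\cdots s_n$, where spot $i$ is occupied by car $c_{s_i}$ after all cars have parked. $\varphi^{-1}(\sigma)\subseteq PF_n$ denotes the fiber. *)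

theory Defs
  imports Complex_Main "HOL-Library.FuncSet" "HOL-Combinatorics.Permutations"
begin

text \<open>A street is a partial map from spots to the cars occupying them. Preference tuples in
  \<open>[n]\<^sup>n\<close> are extensional functions on \<open>{1..n}\<close>, so that distinct functions are distinct tuples.\<close>

type_synonym street = "nat \<rightharpoonup> nat"

text \<open>The first empty spot at or after the preference \<open>a\<close> is \<open>a\<close> itself if \<open>a\<close> is empty. A car that
  fails to park leaves the street unchanged.\<close>

definition park_car :: "nat \<Rightarrow> nat \<Rightarrow> nat \<Rightarrow> street \<Rightarrow> street" where
  "park_car n c a S =
     (let E = {s \<in> {a..n}. S s = None} in if E = {} then S else S(Min E \<mapsto> c))"

primrec street_after :: "nat \<Rightarrow> (nat \<Rightarrow> nat) \<Rightarrow> nat \<Rightarrow> street" where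
  "street_after n \<alpha> 0 = Map.empty"
| "street_after n \<alpha> (Suc k) = park_car n (Suc k) (\<alpha> (Suc k)) (street_after n \<alpha> k)"

definition PF :: "nat \<Rightarrow> (nat \<Rightarrow> nat) set" where
  "PF n = {\<alpha> \<in> {1..n} \<rightarrow>\<^sub>E {1..n}. \<forall>c\<in>{1..n}. \<exists>s\<in>{1..n}. street_after n \<alpha> n s = Some c}"

text \<open>Elements of \<open>S\<^sub>n\<close> are functions that permute \<open>{1..n}\<close>, hence fix every number
  outside it.\<close>

definition outcome :: "nat \<Rightarrow> (nat \<Rightarrow> nat) \<Rightarrow> nat \<Rightarrow> nat" where
  "outcome n \<alpha> i = (if i \<in> {1..n} then the (street_after n \<alpha> n i) else i)"

definition fiber :: "nat \<Rightarrow> (nat \<Rightarrow> nat) \<Rightarrow> (nat \<Rightarrow> nat) set" where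
  "fiber n \<sigma> = {\<alpha> \<in> PF n. outcome n \<alpha> = \<sigma>}"

definition run_length :: "nat \<Rightarrow> (nat \<Rightarrow> nat) \<Rightarrow> nat" where
  "run_length i \<sigma> = Max {card {j..i} | j. j \<in> {1..i} \<and> (\<forall>t\<in>{j..i}. \<sigma> t \<le> \<sigma> i)}"

lemma outcome_permutes:
  assumes "\<alpha> \<in> PF n"
  shows "outcome n \<alpha> permutes {1..n}"
proof -
  define f where "f = (\<lambda>i. the (street_after n \<alpha> n i))"
  have sub: "{1..n} \<subseteq> f ` {1..n}"
  proof
    fix c assume "c \<in> {1..n}"
    then obtain s where "s \<in> {1..n}" "street_after n \<alpha> n s = Some c"
      using assms unfolding PF_def by blast
    then show "c \<in> f ` {1..n}"
      unfolding f_def by (metis imageI option.sel)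
  qed
  have "card (f ` {1..n}) \<le> card {1..n}"
    by (rule card_image_le) simp
  then have eq: "f ` {1..n} = {1..n}"
    using sub by (metis card_seteq finite_atLeastAtMost finite_imageI)
  then have "inj_on f {1..n}"
    by (intro eq_card_imp_inj_on) simp_all
  then have "bij_betw f {1..n} {1..n}"
    using eq by (simp add: bij_betw_def)
  then have "bij_betw (outcome n \<alpha>) {1..n} {1..n}"
    using bij_betw_cong[of "{1..n}" "outcome n \<alpha>" f "{1..n}"] by (simp add: outcome_def f_def)
  then show ?thesis
    by (rule bij_imp_permutes) (auto simp: outcome_def)
qed

end

theory Submission
  imports Defs
begin

text \<open>After the first \<open>k\<close> cars of a tuple in the fiber of \<open>\<sigma>\<close> have parked, the street is
  determined by \<open>\<sigma>\<close>: spot \<open>s\<close> holds \<open>\<sigma> s\<close> if \<open>\<sigma> s \<le> k\<close> and is empty otherwise. So car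
  \<open>\<sigma> i\<close> parks in spot \<open>i\<close> exactly when its preference starts a run of entries ending
  at \<open>i\<close> and bounded by \<open>\<sigma> i\<close>. These conditions on the preferences are independent, so the fiber
  is a product of sets of sizes \<open>run_length i \<sigma>\<close>.\<close>

section \<open>Admissible starting positions of runs\<close>

definition run_starts :: "(nat \<Rightarrow> nat) \<Rightarrow> nat \<Rightarrow> nat set" where
  "run_starts \<sigma> i = {j \<in> {1..i}. \<forall>t\<in>{j..i}. \<sigma> t \<le> \<sigma> i}"

definition partial_street :: "nat \<Rightarrow> (nat \<Rightarrow> nat) \<Rightarrow> nat \<Rightarrow> street" where
  "partial_street n \<sigma> k = (\<lambda>s. if s \<in> {1..n} \<and> \<sigma> s \<le> k then Some (\<sigma> s) else None)"

text \<open>The condition defining \<open>run_starts \<sigma> i\<close> survives moving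
  \<open>j\<close> right towards \<open>i\<close>, so the set is an interval \<open>{m..i}\<close>.
  The longest run ending at \<open>i\<close> starts at \<open>m\<close>, so its length is also the
  number of admissible starts.\<close>

lemma card_run_starts:
  assumes "i \<ge> 1"
  shows "card (run_starts \<sigma> i) = run_length i \<sigma>"
proof -
  define m where "m = Min (run_starts \<sigma> i)"
  have fin: "finite (run_starts \<sigma> i)" by (simp add: run_starts_def)
  have "i \<in> run_starts \<sigma> i" using assms by (auto simp: run_starts_def)
  then have m: "m \<in> run_starts \<sigma> i" unfolding m_def using fin by (metis Min_in empty_iff)
  have le: "m \<le> j" if "j \<in> run_starts \<sigma> i" for j
    unfolding m_def using fin that by simp
  have "run_starts \<sigma> i = {m..i}"
  proof
    show "run_starts \<sigma> i \<subseteq> {m..i}" using le by (auto simp: run_starts_def)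
    show "{m..i} \<subseteq> run_starts \<sigma> i" using m by (auto simp: run_starts_def)
  qed
  moreover have "run_length i \<sigma> = card {m..i}"
  proof -
    have eq: "{card {j..i} | j. j \<in> {1..i} \<and> (\<forall>t\<in>{j..i}. \<sigma> t \<le> \<sigma> i)}
        = (\<lambda>j. card {j..i}) ` run_starts \<sigma> i"
      by (auto simp: run_starts_def)
    show ?thesis unfolding run_length_def eq
      using fin m le by (intro Max_eqI) (auto intro: diff_le_mono2)
  qed
  ultimately show ?thesis by simp
qed

section \<open>A single parking move\<close>

lemma park_car_full:
  "{s \<in> {a..n}. S s = None} = {} \<Longrightarrow> park_car n c a S = S"
  unfolding park_car_def Let_def by (rule if_P)

lemma park_car_free:
  "{s \<in> {a..n}. S s = None} \<noteq> {}
    \<Longrightarrow> park_car n c a S = S(Min {s \<in> {a..n}. S s = None} \<mapsto> c)"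
  unfolding park_car_def Let_def by (rule if_not_P)

lemma park_car_cases:
  obtains "park_car n c a S = S"
  | s where "s \<in> {a..n}" "S s = None" "park_car n c a S = S(s \<mapsto> c)"
proof (cases "{s \<in> {a..n}. S s = None} = {}")
  case True
  then show ?thesis by (intro that(1) park_car_full)
next
  case False
  then have "Min {s \<in> {a..n}. S s = None} \<in> {s \<in> {a..n}. S s = None}"
    by (intro Min_in) auto
  then show ?thesis
    using that(2) park_car_free[OF False] by blast
qed

text \<open>Together with \<open>park_car_updD\<close> this replaces the minimum in
  \<open>park_car\<close> by a local test: spot \<open>i\<close> is free and no spot from
  \<open>a\<close> up to \<open>i\<close> is.\<close>

lemma park_car_updI:
  assumes "i \<in> {a..n}" "S i = None" "\<And>t. t \<in> {a..<i} \<Longrightarrow> S t \<noteq> None"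
  shows "park_car n c a S = S(i \<mapsto> c)"
proof -
  have "i \<le> t" if "t \<in> {a..n}" "S t = None" for t
    using assms(3)[of t] that by (cases "t < i") auto
  then have "Min {s \<in> {a..n}. S s = None} = i"
    using assms(1,2) by (intro Min_eqI) auto
  moreover have "{s \<in> {a..n}. S s = None} \<noteq> {}" using assms by blast
  note park_car_free[OF this, of c]
  ultimately show ?thesis by (simp only:)
qed

lemma park_car_updD:
  assumes "park_car n c a S i = Some c" "S i = None"
  shows "i \<in> {a..n} \<and> (\<forall>t\<in>{a..<i}. S t \<noteq> None)"
proof -
  let ?E = "{s \<in> {a..n}. S s = None}"
  have ne: "?E \<noteq> {}"
  proof
    assume "?E = {}"
    from park_car_full[OF this] show False using assms by simp
  qed
  \<comment> \<open>A move changes only the spot \<open>Min ?E\<close>, and spot \<open>i\<close>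
    changes from empty to occupied.\<close>
  have i: "i = Min ?E"
  proof (rule ccontr)
    assume "i \<noteq> Min ?E"
    then have "(S(Min ?E \<mapsto> c)) i = S i" by (rule fun_upd_other)
    then show False using assms park_car_free[OF ne, of c] by simp
  qed
  have "i \<in> ?E" unfolding i using ne by (intro Min_in) auto
  moreover have "S t \<noteq> None" if "t \<in> {a..<i}" for t
  proof
    assume "S t = None"
    then have "t \<in> ?E" using that \<open>i \<in> ?E\<close> by auto
    then have "Min ?E \<le> t" by (intro Min_le) auto
    then show False using that i by simp
  qed
  ultimately show ?thesis by auto
qed

section \<open>Evolution of the street\<close>

lemma street_after_car_le:
  "street_after n \<alpha> k s = Some c \<Longrightarrow> c \<le> k"
proof (induction k arbitrary: s)
  case (Suc k)
  then show ?case
    by (cases rule: park_car_cases[of n "Suc k" "\<alpha> (Suc k)" "street_after n \<alpha> k"])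
      (auto split: if_splits intro: le_SucI)
qed simp

text \<open>A car enters only an empty spot and never leaves it, and cars arriving after time
  \<open>k\<close> have numbers above \<open>k\<close>. Hence a later street determines every
  earlier one by erasing the later cars.\<close>

lemma street_after_prefix:
  assumes "k \<le> m"
  shows "street_after n \<alpha> k s = Some c \<longleftrightarrow> street_after n \<alpha> m s = Some c \<and> c \<le> k"
  using assms
proof (induction m rule: dec_induct)
  case base
  then show ?case using street_after_car_le by blast
next
  case (step m)
  then show ?case
    by (cases rule: park_car_cases[of n "Suc m" "\<alpha> (Suc m)" "street_after n \<alpha> m"]) auto
qed

text \<open>Streets are maps on all naturals, so comparing them with \<open>partial_street\<close>
  also requires their values off \<open>{1..n}\<close>.\<close>

lemma street_after_outside:
  assumes "\<alpha> \<in> {1..n} \<rightarrow> {1..n}" "k \<le> n" "s \<notin> {1..n}"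
  shows "street_after n \<alpha> k s = None"
  using assms(2)
proof (induction k)
  case (Suc k)
  then have "\<alpha> (Suc k) \<in> {1..n}" using assms(1) by (intro funcset_mem[OF assms(1)]) auto
  with Suc assms(3) show ?case
    by (cases rule: park_car_cases[of n "Suc k" "\<alpha> (Suc k)" "street_after n \<alpha> k"]) auto
qed simp

section \<open>The fiber in terms of streets\<close>

lemma fiber_iff_street:
  assumes \<sigma>: "\<sigma> permutes {1..n}" and \<alpha>: "\<alpha> \<in> {1..n} \<rightarrow>\<^sub>E {1..n}"
  shows "\<alpha> \<in> fiber n \<sigma> \<longleftrightarrow> street_after n \<alpha> n = partial_street n \<sigma> n"
proof
  assume fib: "\<alpha> \<in> fiber n \<sigma>"
  show "street_after n \<alpha> n = partial_street n \<sigma> n"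
  proof
    fix s
    show "street_after n \<alpha> n s = partial_street n \<sigma> n s"
    proof (cases "s \<in> {1..n}")
      case True
      then have in_n: "\<sigma> s \<in> {1..n}" using \<sigma> by (simp only: permutes_in_image)
      \<comment> \<open>Since \<open>outcome\<close> uses \<open>the\<close>, its value at
        \<open>s\<close> alone does not show that spot \<open>s\<close> is occupied. So start from
        the spot \<open>s'\<close> where car \<open>\<sigma> s\<close> parks, and identify it with
        \<open>s\<close> by injectivity of \<open>\<sigma>\<close>.\<close>
      then obtain s' where s': "s' \<in> {1..n}" "street_after n \<alpha> n s' = Some (\<sigma> s)"
        using fib unfolding fiber_def PF_def by blast
      have "\<sigma> s' = outcome n \<alpha> s'" using fib by (simp add: fiber_def)
      also have "\<dots> = \<sigma> s" using s' by (simp add: outcome_def)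
      finally have "s' = s" using permutes_inj[OF \<sigma>] by (simp add: inj_eq)
      then show ?thesis using s' in_n by (simp add: partial_street_def)
    next
      case False
      then have "street_after n \<alpha> n s = None"
        using \<alpha> by (intro street_after_outside) auto
      with False show ?thesis by (simp only: partial_street_def simp_thms if_False)
    qed
  qed
next
  assume eq: "street_after n \<alpha> n = partial_street n \<sigma> n"
  have at: "street_after n \<alpha> n s = Some (\<sigma> s)" if "s \<in> {1..n}" for s
    using that permutes_in_image[OF \<sigma>, of s] by (simp add: eq partial_street_def)
  have "\<exists>s\<in>{1..n}. street_after n \<alpha> n s = Some c" if "c \<in> {1..n}" for c
    using at that permutes_image[OF \<sigma>] by (metis imageE)
  moreover have "outcome n \<alpha> = \<sigma>"
  proof
    fix i show "outcome n \<alpha> i = \<sigma> i"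
    proof (cases "i \<in> {1..n}")
      case True
      with at[OF True] show ?thesis by (simp add: outcome_def)
    next
      case False
      with permutes_not_in[OF \<sigma> False] show ?thesis by (simp only: outcome_def if_False)
    qed
  qed
  ultimately show "\<alpha> \<in> fiber n \<sigma>" using \<alpha> by (simp add: fiber_def PF_def)
qed

text \<open>Passing to \<open>Suc k\<close> fills exactly spot \<open>i\<close>, so the move must
  end there: the spots from \<open>j\<close> up to \<open>i\<close> must hold entries at most
  \<open>k\<close>. As only \<open>i\<close> carries the entry \<open>Suc k\<close>, this is the
  bound by \<open>\<sigma> i\<close> in \<open>run_starts\<close>.\<close>

lemma park_car_partial_street:
  assumes \<sigma>: "\<sigma> permutes {1..n}" and i: "i \<in> {1..n}" "\<sigma> i = Suc k" and j: "j \<in> {1..n}"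
  shows "park_car n (Suc k) j (partial_street n \<sigma> k) = partial_street n \<sigma> (Suc k)
    \<longleftrightarrow> j \<in> run_starts \<sigma> i"
proof
  assume "park_car n (Suc k) j (partial_street n \<sigma> k) = partial_street n \<sigma> (Suc k)"
  then have "i \<in> {j..n} \<and> (\<forall>t\<in>{j..<i}. partial_street n \<sigma> k t \<noteq> None)"
    using i by (intro park_car_updD[of n "Suc k"]) (simp_all add: partial_street_def)
  then show "j \<in> run_starts \<sigma> i"
    using i j by (force simp: run_starts_def partial_street_def split: if_splits)
next
  assume "j \<in> run_starts \<sigma> i"
  then have le: "j \<le> i" "\<And>t. t \<in> {j..i} \<Longrightarrow> \<sigma> t \<le> Suc k"
    using i by (auto simp: run_starts_def)
  have neq: "\<sigma> t \<noteq> Suc k" if "t \<noteq> i" for t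
    using that i(2) permutes_inj[OF \<sigma>] by (metis injD)
  have "park_car n (Suc k) j (partial_street n \<sigma> k) = (partial_street n \<sigma> k)(i \<mapsto> Suc k)"
  proof (rule park_car_updI)
    show "partial_street n \<sigma> k t \<noteq> None" if "t \<in> {j..<i}" for t
      using le(2)[of t] neq[of t] that i j by (simp add: partial_street_def)
  qed (use i j le in \<open>auto simp: partial_street_def\<close>)
  also have "\<dots> = partial_street n \<sigma> (Suc k)"
    using i neq by (auto simp: fun_eq_iff partial_street_def le_Suc_eq)
  finally show "park_car n (Suc k) j (partial_street n \<sigma> k) = partial_street n \<sigma> (Suc k)" .
qed

text \<open>Forwards, the final street fixes all intermediate ones, so each move is one between
  consecutive partial streets. Backwards, the moves compose by induction on the number of
  cars.\<close>

lemma street_after_eq_partial_street_iff: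
  assumes \<sigma>: "\<sigma> permutes {1..n}" and \<alpha>: "\<alpha> \<in> {1..n} \<rightarrow> {1..n}"
  shows "street_after n \<alpha> n = partial_street n \<sigma> n
    \<longleftrightarrow> (\<forall>i\<in>{1..n}. \<alpha> (\<sigma> i) \<in> run_starts \<sigma> i)"
proof
  assume eq: "street_after n \<alpha> n = partial_street n \<sigma> n"
  have prefix: "street_after n \<alpha> k = partial_street n \<sigma> k" if "k \<le> n" for k
  proof
    fix s
    have "street_after n \<alpha> k s = Some c \<longleftrightarrow> partial_street n \<sigma> k s = Some c" for c
      using that street_after_prefix[OF that, of n \<alpha> s c]
      by (auto simp: eq partial_street_def split: if_splits)
    then show "street_after n \<alpha> k s = partial_street n \<sigma> k s"
      by (metis not_None_eq)
  qed
  show "\<forall>i\<in>{1..n}. \<alpha> (\<sigma> i) \<in> run_starts \<sigma> i"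
  proof
    fix i assume i: "i \<in> {1..n}"
    then have in_n: "\<sigma> i \<in> {1..n}" using \<sigma> by (simp only: permutes_in_image)
    then obtain k where k: "\<sigma> i = Suc k" by (cases "\<sigma> i") auto
    have "park_car n (Suc k) (\<alpha> (Suc k)) (partial_street n \<sigma> k) = partial_street n \<sigma> (Suc k)"
      using prefix[of k] prefix[of "Suc k"] in_n k by simp
    then show "\<alpha> (\<sigma> i) \<in> run_starts \<sigma> i"
      using park_car_partial_street[OF \<sigma> i k, of "\<alpha> (Suc k)"] funcset_mem[OF \<alpha> in_n] k
      by simp
  qed
next
  assume starts: "\<forall>i\<in>{1..n}. \<alpha> (\<sigma> i) \<in> run_starts \<sigma> i"
  have "street_after n \<alpha> k = partial_street n \<sigma> k" if "k \<le> n" for k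
    using that
  proof (induction k)
    case 0
    \<comment> \<open>Car numbers start at 1, so the partial street for \<open>k = 0\<close> is
      empty.\<close>
    have "\<sigma> s \<noteq> 0" if "s \<in> {1..n}" for s
      using permutes_in_image[OF \<sigma>, of s] that by auto
    then show ?case by (auto simp: fun_eq_iff partial_street_def)
  next
    case (Suc k)
    then have in_n: "Suc k \<in> {1..n}" by simp
    then obtain i where i: "i \<in> {1..n}" "\<sigma> i = Suc k"
      using permutes_image[OF \<sigma>] by (metis imageE)
    then show ?case
      using park_car_partial_street[OF \<sigma> i funcset_mem[OF \<alpha> in_n]] starts Suc i by force
  qed
  then show "street_after n \<alpha> n = partial_street n \<sigma> n" by simp
qed

section \<open>Product form and counting\<close>

text \<open>The condition at position \<open>i\<close> concerns only the preference of car
  \<open>\<sigma> i\<close>. Indexing by cars \<open>c = \<sigma> i\<close> therefore gives one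
  independent condition per coordinate of \<open>\<alpha>\<close>.\<close>

lemma fiber_eq_PiE:
  assumes \<sigma>: "\<sigma> permutes {1..n}"
  shows "fiber n \<sigma> = (\<Pi>\<^sub>E c\<in>{1..n}. run_starts \<sigma> (inv \<sigma> c))"
proof -
  have starts_sub: "run_starts \<sigma> (inv \<sigma> c) \<subseteq> {1..n}" if "c \<in> {1..n}" for c
    using permutes_in_image[OF permutes_inv[OF \<sigma>], of c] that by (auto simp: run_starts_def)
  have reindex: "(\<forall>i\<in>{1..n}. \<alpha> (\<sigma> i) \<in> run_starts \<sigma> i)
      \<longleftrightarrow> (\<forall>c\<in>{1..n}. \<alpha> c \<in> run_starts \<sigma> (inv \<sigma> c))" for \<alpha>
    using permutes_in_image[OF \<sigma>] permutes_in_image[OF permutes_inv[OF \<sigma>]]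
      permutes_inverses[OF \<sigma>] by metis
  have iff: "\<alpha> \<in> fiber n \<sigma> \<longleftrightarrow> (\<forall>c\<in>{1..n}. \<alpha> c \<in> run_starts \<sigma> (inv \<sigma> c))"
    if "\<alpha> \<in> {1..n} \<rightarrow>\<^sub>E {1..n}" for \<alpha>
    using fiber_iff_street[OF \<sigma> that] street_after_eq_partial_street_iff[OF \<sigma>, of \<alpha>]
      reindex[of \<alpha>] that by (simp add: PiE_def)
  have fiber_sub: "fiber n \<sigma> \<subseteq> {1..n} \<rightarrow>\<^sub>E {1..n}" by (auto simp: fiber_def PF_def)
  have PiE_sub: "(\<Pi>\<^sub>E c\<in>{1..n}. run_starts \<sigma> (inv \<sigma> c)) \<subseteq> {1..n} \<rightarrow>\<^sub>E {1..n}"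
    using starts_sub by (intro PiE_mono)
  show ?thesis
  proof (rule set_eqI)
    fix \<alpha>
    show "\<alpha> \<in> fiber n \<sigma> \<longleftrightarrow> \<alpha> \<in> (\<Pi>\<^sub>E c\<in>{1..n}. run_starts \<sigma> (inv \<sigma> c))"
    proof (cases "\<alpha> \<in> {1..n} \<rightarrow>\<^sub>E {1..n}")
      case True
      with iff[OF True] show ?thesis by (simp add: PiE_iff)
    next
      case False
      from contra_subsetD[OF fiber_sub False] contra_subsetD[OF PiE_sub False]
      show ?thesis by (simp only:)
    qed
  qed
qed

theorem proposition3p3:
  fixes n :: nat and \<sigma> :: "nat \<Rightarrow> nat"
  assumes "n \<ge> 1"
    and "\<sigma> permutes {1..n}"
  shows "card (fiber n \<sigma>) = (\<Prod>i=1..n. run_length i \<sigma>)"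
proof -
  have "card (fiber n \<sigma>) = (\<Prod>c=1..n. card (run_starts \<sigma> (inv \<sigma> c)))"
    by (simp add: fiber_eq_PiE[OF assms(2)] card_PiE)
  also have "\<dots> = (\<Prod>i=1..n. card (run_starts \<sigma> i))"
    \<comment> \<open>Substituting \<open>i = inv \<sigma> c\<close> turns the product over cars
      into one over spots.\<close>
    using prod.permute[OF permutes_inv[OF assms(2)], of "\<lambda>i. card (run_starts \<sigma> i)"]
    by (simp add: o_def)
  also have "\<dots> = (\<Prod>i=1..n. run_length i \<sigma>)"
    by (intro prod.cong) (auto simp: card_run_starts)
  finally show ?thesis .
qed

end
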